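(* For every integer $n\ge 1$, the edgeless graph $\overline{K_n}$ on $n$ vertices (the complement of the complete graph $K_n$) satisfies $\mathrm{USN}(\overline{K_n}) = 1+\lceil \log_2 n\rceil$.
   Context: Graphs are finite, simple and undirected. A valid labelling of a graph $G$ with universe a finite set $S$ assigns to the vertices of $G$ pairwise distinct nonempty subsets of $S$ such that two distinct vertices are adjacent if and only if their labels are disjoint. The universe size number $\mathrm{USN}(G)$ is the minimum of $|S|$ over all finite sets $S$ for which $G$ has a valid labelling with universe $S$. *)

theory Defs
  imports Complex_Main "Graph_Theory.Kuratowski"
begin

text \<open>
  Finite simple undirected graphs are the symmetric digraphs of the locale
  \<^locale>\<open>graph\<close> (finite, without loops or parallel arcs); vertices \<open>u\<close> and \<open>v\<close> are adjacent
  iff \<open>u \<rightarrow>\<^bsub>G\<^esub> v\<close>.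
\<close>

definition graph_complement :: "'v pair_pre_digraph \<Rightarrow> 'v pair_pre_digraph" where
  "graph_complement G =
     \<lparr> pverts = pverts G,
       parcs = {(u, v). u \<in> pverts G \<and> v \<in> pverts G \<and> u \<noteq> v \<and> (u, v) \<notin> parcs G} \<rparr>"

definition valid_labelling :: "('v, 'e) pre_digraph \<Rightarrow> 's set \<Rightarrow> ('v \<Rightarrow> 's set) \<Rightarrow> bool" where
  "valid_labelling G S f \<longleftrightarrow>
     finite S \<and>
     (\<forall>v \<in> verts G. f v \<subseteq> S \<and> f v \<noteq> {}) \<and>
     inj_on f (verts G) \<and>
     (\<forall>u \<in> verts G. \<forall>v \<in> verts G. u \<noteq> v \<longrightarrow> (u \<rightarrow>\<^bsub>G\<^esub> v \<longleftrightarrow> f u \<inter> f v = {}))"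

text \<open>
  A definition cannot quantify over the type of the universe. Universes of natural numbers
  suffice: \<open>USN_le\<close> bounds \<open>USN\<close> by the size of a universe of any type, and \<open>USN_attained\<close>
  shows that the minimum exists for every graph.
\<close>

definition USN :: "('v, 'e) pre_digraph \<Rightarrow> nat" where
  "USN G = (LEAST k. \<exists>(S :: nat set) f. valid_labelling G S f \<and> card S = k)"

lemma valid_labelling_image:
  assumes "valid_labelling G S f" and "inj_on h S"
  shows "valid_labelling G (h ` S) (\<lambda>v. h ` f v)"
proof -
  have sub: "f v \<subseteq> S" if "v \<in> verts G" for v
    using assms(1) that by (auto simp: valid_labelling_def)
  have "inj_on (\<lambda>v. h ` f v) (verts G)"
    using assms sub unfolding valid_labelling_def
    by (intro inj_onI) (metis inj_on_image_eq_iff inj_onD)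
  moreover have "h ` f u \<inter> h ` f v = {} \<longleftrightarrow> f u \<inter> f v = {}"
    if "u \<in> verts G" "v \<in> verts G" for u v
    using inj_on_image_Int[OF assms(2) sub[OF that(1)] sub[OF that(2)]] by auto
  ultimately show ?thesis
    using assms(1) by (simp add: valid_labelling_def image_mono)
qed

lemma valid_labelling_nat:
  fixes S :: "'s set"
  assumes "valid_labelling G S f"
  shows "\<exists>(T :: nat set) g. valid_labelling G T g \<and> card T = card S"
proof -
  have "finite S" using assms by (simp add: valid_labelling_def)
  then obtain h :: "'s \<Rightarrow> nat" where h: "inj_on h S"
    using finite_imp_inj_to_nat_seg[of S] by auto
  show ?thesis
  proof (intro exI conjI)
    show "valid_labelling G (h ` S) (\<lambda>v. h ` f v)" using assms h by (rule valid_labelling_image)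
    show "card (h ` S) = card S" using h by (rule card_image)
  qed
qed

lemma USN_le:
  fixes S :: "'s set"
  assumes "valid_labelling G S f"
  shows "USN G \<le> card S"
  unfolding USN_def using valid_labelling_nat[OF assms] by (intro Least_le)

lemma (in graph) valid_labelling_exists:
  "\<exists>(S :: 'a set set) f. valid_labelling G S f"
proof -
  define f where "f v = {{v, w} | w. w \<in> verts G \<and> \<not> v \<rightarrow>\<^bsub>G\<^esub> w}" for v
  have self: "{v} \<in> f v" if "v \<in> verts G" for v
  proof -
    have "\<not> v \<rightarrow>\<^bsub>G\<^esub> v" using adj_not_same by blast
    then show ?thesis using that unfolding f_def by blast
  qed
  have sym: "v \<rightarrow>\<^bsub>G\<^esub> u" if "u \<rightarrow>\<^bsub>G\<^esub> v" for u v
    using arcs_ends_symmetric[OF sym_arcs that] .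
  have inj: "inj_on f (verts G)"
  proof (rule inj_onI)
    fix u v assume "u \<in> verts G" "f u = f v"
    then have "{u} \<in> f v" using self by blast
    then show "u = v" by (auto simp: f_def)
  qed
  have adj: "u \<rightarrow>\<^bsub>G\<^esub> v \<longleftrightarrow> f u \<inter> f v = {}"
    if "u \<in> verts G" "v \<in> verts G" "u \<noteq> v" for u v
  proof
    assume a: "u \<rightarrow>\<^bsub>G\<^esub> v"
    show "f u \<inter> f v = {}"
    proof (rule ccontr)
      assume "f u \<inter> f v \<noteq> {}"
      then obtain w x where w: "\<not> u \<rightarrow>\<^bsub>G\<^esub> w" and e: "{u, w} = {v, x}"
        unfolding f_def by blast
      from e \<open>u \<noteq> v\<close> have "w = v" by (auto simp: doubleton_eq_iff)
      with w a show False by blast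
    qed
  next
    assume d: "f u \<inter> f v = {}"
    show "u \<rightarrow>\<^bsub>G\<^esub> v"
    proof (rule ccontr)
      assume n: "\<not> u \<rightarrow>\<^bsub>G\<^esub> v"
      then have "{u, v} \<in> f u" using that unfolding f_def by blast
      moreover have "{v, u} \<in> f v" using n that sym unfolding f_def by blast
      moreover have "{v, u} = {u, v}" by (rule insert_commute)
      ultimately show False using d by auto
    qed
  qed
  have sub: "f v \<subseteq> Pow (verts G)" if "v \<in> verts G" for v
    using that unfolding f_def by blast
  have "valid_labelling G (Pow (verts G)) f"
    unfolding valid_labelling_def
  proof (intro conjI ballI impI)
    show "f v \<noteq> {}" if "v \<in> verts G" for v using self[OF that] by blast
  qed (use inj adj sub in \<open>simp_all add: finite_verts\<close>)
  then show ?thesis by blast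
qed

lemma (in graph) USN_attained:
  "\<exists>(S :: nat set) f. valid_labelling G S f \<and> card S = USN G"
proof -
  obtain S :: "'a set set" and f where "valid_labelling G S f"
    using valid_labelling_exists by blast
  then have "\<exists>k. \<exists>(T :: nat set) g. valid_labelling G T g \<and> card T = k"
    using valid_labelling_nat by blast
  then show ?thesis unfolding USN_def by (rule LeastI_ex)
qed

lemma graph_graph_complement:
  assumes "graph (with_proj G)"
  shows "graph (with_proj (graph_complement G))"
proof -
  interpret pair_graph G using assms by (rule pair_graphI_graph)
  have "finite (parcs (graph_complement G))"
    by (rule finite_subset[of _ "pverts G \<times> pverts G"])
      (auto simp: graph_complement_def pair_finite_verts)
  moreover have "sym (parcs (graph_complement G))"
    using arcs_symmetric by (auto simp: graph_complement_def sym_def)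
  ultimately have "pair_graph (graph_complement G)"
    using pair_finite_verts
    by unfold_locales (auto simp: graph_complement_def symmetric_def)
  then show ?thesis by (rule pair_graph.pair_graphD_graph)
qed

lemma graph_complement_complete:
  assumes "K\<^bsub>n\<^esub> (with_proj G)"
  shows "parcs (graph_complement G) = {}"
    and "finite (pverts (graph_complement G))"
    and "card (pverts (graph_complement G)) = n"
proof -
  have G: "graph (with_proj G)" "card (pverts G) = n"
    and arcs: "parcs G = {(u, v). (u, v) \<in> pverts G \<times> pverts G \<and> u \<noteq> v}"
    using assms unfolding complete_digraph_def with_proj_simps by blast+
  show "parcs (graph_complement G) = {}"
    unfolding graph_complement_def arcs by auto
  show "card (pverts (graph_complement G)) = n"
    using G(2) by (simp add: graph_complement_def)
  interpret pair_graph G using G(1) by (rule pair_graphI_graph)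
  show "finite (pverts (graph_complement G))"
    using pair_finite_verts by (simp add: graph_complement_def)
qed

end

theory Submission
  imports Defs
begin

text \<open>
  In an edgeless graph all labels meet pairwise. An intersecting family contains at most one set
  of each complementary pair of subsets of \<open>S\<close>, hence has at most half of the \<open>2 ^ card S\<close>
  subsets as members; the subsets of \<open>S\<close> containing a fixed point attain this bound.
\<close>

lemma card_intersecting_family_le:
  assumes "finite S" "F \<subseteq> Pow S" and int: "\<And>A B. A \<in> F \<Longrightarrow> B \<in> F \<Longrightarrow> A \<inter> B \<noteq> {}"
  shows "2 * card F \<le> 2 ^ card S"
proof -
  let ?C = "(\<lambda>A. S - A) ` F"
  have "finite F" using assms(1,2) by (meson finite_Pow_iff finite_subset)
  have "inj_on (\<lambda>A. S - A) F"
    using assms(2) by (intro inj_onI) (metis PowD double_diff subsetD subset_refl)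
  then have "card ?C = card F" by (rule card_image)
  \<comment> \<open>A common element would be a member \<open>A = S - B\<close> with
    \<open>B\<close> in \<open>F\<close>, and then \<open>A\<close> and \<open>B\<close> would be
    disjoint.\<close>
  moreover have "F \<inter> ?C = {}" using int by blast
  ultimately have "2 * card F = card (F \<union> ?C)"
    using \<open>finite F\<close> by (simp add: card_Un_disjoint)
  also have "\<dots> \<le> card (Pow S)" using assms(1,2) by (intro card_mono) auto
  finally show ?thesis using assms(1) by (simp add: card_Pow)
qed

lemma valid_labelling_edgeless_le:
  assumes "valid_labelling H S f" and "\<And>u v. \<not> u \<rightarrow>\<^bsub>H\<^esub> v"
  shows "2 * card (verts H) \<le> 2 ^ card S"
proof -
  have "2 * card (f ` verts H) \<le> 2 ^ card S"
  proof (rule card_intersecting_family_le)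
    fix A B assume "A \<in> f ` verts H" "B \<in> f ` verts H"
    then obtain u v where "u \<in> verts H" "v \<in> verts H" "A = f u" "B = f v" by blast
    \<comment> \<open>For \<open>u = v\<close> the intersection is a single label, which is nonempty
      by validity; for distinct vertices it is non-adjacency that forces the labels to meet.\<close>
    then show "A \<inter> B \<noteq> {}" using assms by (cases "u = v") (auto simp: valid_labelling_def)
  qed (use assms in \<open>auto simp: valid_labelling_def\<close>)
  moreover have "card (f ` verts H) = card (verts H)"
    using assms(1) by (simp add: valid_labelling_def card_image)
  ultimately show ?thesis by simp
qed

text \<open>The top element \<open>m\<close> of \<open>{..m}\<close> serves as the common point of
  all labels; the remaining \<open>m\<close> elements offer \<open>2 ^ m\<close> subsets to tell the
  vertices apart.\<close>

lemma valid_labelling_edgeless_exists: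
  assumes "finite (verts H)" "card (verts H) \<le> 2 ^ m" and "\<And>u v. \<not> u \<rightarrow>\<^bsub>H\<^esub> v"
  shows "\<exists>f. valid_labelling H {..m} f"
proof -
  have "card (verts H) \<le> card (Pow {..<m})" using assms(2) by (simp add: card_Pow)
  then obtain g where g: "g ` verts H \<subseteq> Pow {..<m}" "inj_on g (verts H)"
    using card_le_inj[OF assms(1), of "Pow {..<m}"] by auto
  then have lt: "g v \<subseteq> {..<m}" if "v \<in> verts H" for v using that by blast
  have "inj_on (\<lambda>v. insert m (g v)) (verts H)"
  proof (rule inj_onI)
    fix u v assume uv: "u \<in> verts H" "v \<in> verts H" "insert m (g u) = insert m (g v)"
    moreover have "m \<notin> g u" "m \<notin> g v" using uv lt by blast+
    ultimately show "u = v" using g(2) by (metis inj_onD insert_ident)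
  qed
  then have "valid_labelling H {..m} (\<lambda>v. insert m (g v))"
    using lt assms(3) by (fastforce simp: valid_labelling_def)
  then show ?thesis by blast
qed

text \<open>Trades the ceiling for a comparison with powers of two. The upper bound on
  \<open>USN\<close> uses it from left to right, the lower bound from right to left.\<close>

lemma ceiling_log2_le_iff:
  assumes "n \<ge> 1"
  shows "\<lceil>log 2 (real n)\<rceil> \<le> int j \<longleftrightarrow> n \<le> 2 ^ j"
proof -
  have "\<lceil>log 2 (real n)\<rceil> \<le> int j \<longleftrightarrow> log 2 (real n) \<le> real j"
    by (simp add: ceiling_le_iff)
  also have "\<dots> \<longleftrightarrow> real n \<le> 2 ^ j"
    using assms by (simp add: log_le_iff powr_realpow)
  finally show ?thesis by (metis of_nat_le_iff of_nat_numeral of_nat_power)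
qed

theorem theorem8:
  fixes n :: nat and G :: "'v pair_pre_digraph"
  assumes "n \<ge> 1" and "K\<^bsub>n\<^esub> (with_proj G)"
  shows "int (USN (with_proj (graph_complement G))) = 1 + \<lceil>log 2 (real n)\<rceil>"
proof -
  let ?H = "with_proj (graph_complement G)"
  note H = graph_complement_complete[OF assms(2)]
  have edgeless: "\<not> u \<rightarrow>\<^bsub>?H\<^esub> v" for u v
    using H(1) by (simp add: arcs_ends_def)
  \<comment> \<open>Nonnegativity, which comes from \<open>n \<ge> 1\<close>, lets the integer
    ceiling be replaced by a natural number \<open>m\<close>.\<close>
  have "log 2 (real n) \<ge> 0" using assms(1) by simp
  then obtain m where m: "\<lceil>log 2 (real n)\<rceil> = int m"
    by (metis ceiling_mono ceiling_zero nonneg_int_cases)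
  have "USN ?H = Suc m"
    unfolding USN_def
  proof (rule Least_equality)
    have "n \<le> 2 ^ m" using ceiling_log2_le_iff[OF assms(1), of m] m by simp
    then obtain f where "valid_labelling ?H {..m} f"
      using valid_labelling_edgeless_exists[of ?H m] H edgeless by auto
    then show "\<exists>(S :: nat set) f. valid_labelling ?H S f \<and> card S = Suc m"
      by (metis card_atMost)
  next
    fix k assume "\<exists>(S :: nat set) f. valid_labelling ?H S f \<and> card S = k"
    then have k: "2 * n \<le> 2 ^ k"
      using valid_labelling_edgeless_le[OF _ edgeless] H(3) by fastforce
    \<comment> \<open>\<open>k = 0\<close> would give \<open>2 * n \<le> 1\<close>. Cancelling the
      factor 2 then lowers the exponent by one, which is the source of the summand 1 in the
      formula.\<close>
    with assms(1) obtain j where "k = Suc j" by (cases k) auto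
    with k have "n \<le> 2 ^ j" by simp
    then show "Suc m \<le> k"
      using ceiling_log2_le_iff[OF assms(1), of j] m \<open>k = Suc j\<close> by simp
  qed
  then show ?thesis using m by simp
qed

end
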